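(* Let $G$ be a planar graph that has a Hamiltonian cycle $H$. Then for any embedding of $G$ in the plane there exists an isobaric partition of the set of all faces of the embedding whose border is $H$ (i.e. is exactly the set of edges of $H$).
   Context: "Graph" means a finite connected undirected graph without loops, multiple edges, or vertices of degree one. For an embedding of a planar graph in the plane, the faces are the connected components of the complement of the drawing, including the unbounded (outer) face. The weight of a face bounded by an elementary cycle is the length of this bounding cycle (the number of vertices on the border of the face) minus two. (In a planar graph with a Hamiltonian cycle, every face of every embedding is bounded by an elementary cycle.) A partition of the set of all faces of the embedding into two subsets is called isobaric if the two subsets have equal total weights, i.e. $S_1=S_2$, where $S_1$ and $S_2$ denote the sums of the weights of the faces in the first and second subset respectively. The border of such a partition is the set of all edges that lie both on the boundary of a face of the first subset and on the boundary of a face of the second subset. *)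

theory Defs
  imports "HOL-Analysis.Analysis"
begin

section \<open>Graphs\<close>

text \<open>A graph is given by its vertex set and its set of edges, an edge being the set of
  its two (distinct) ends; loops and multiple edges are thereby excluded.\<close>

definition graph_degree :: "'a set set \<Rightarrow> 'a \<Rightarrow> nat" where
  "graph_degree E v = card {e \<in> E. v \<in> e}"

locale simple_graph =
  fixes V :: "'a set" and E :: "'a set set"
  assumes finite_vertices: "finite V"
    and nonempty: "V \<noteq> {}"
    and edges: "\<And>e. e \<in> E \<Longrightarrow> e \<subseteq> V \<and> card e = 2"
    and graph_connected: "\<And>u v. u \<in> V \<Longrightarrow> v \<in> V \<Longrightarrow> (u, v) \<in> {(x, y). {x, y} \<in> E}\<^sup>*"
    and degree_not_one: "\<And>v. v \<in> V \<Longrightarrow> graph_degree E v \<noteq> 1"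

text \<open>An elementary cycle is represented by the list of its vertices in cyclic order, so
  its length is the length of the list; the first vertex is not repeated at the end.\<close>

definition cycle_edges :: "'a list \<Rightarrow> 'a set set" where
  "cycle_edges c = {{c ! i, c ! (Suc i mod length c)} | i. i < length c}"

definition elementary_cycle :: "'a set set \<Rightarrow> 'a list \<Rightarrow> bool" where
  "elementary_cycle E c \<longleftrightarrow> 3 \<le> length c \<and> distinct c \<and> cycle_edges c \<subseteq> E"

definition hamiltonian_cycle :: "'a set \<Rightarrow> 'a set set \<Rightarrow> 'a list \<Rightarrow> bool" where
  "hamiltonian_cycle V E c \<longleftrightarrow> elementary_cycle E c \<and> set c = V"

section \<open>Plane embeddings\<close>

text \<open>The plane is the type of complex numbers. Vertex \<open>v\<close> is drawn at the point \<open>pos v\<close>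
  and edge \<open>e\<close> as the simple arc \<open>crv e\<close>; how an arc is oriented is irrelevant.\<close>

locale plane_embedding = simple_graph V E
  for V :: "'a set" and E :: "'a set set" +
  fixes pos :: "'a \<Rightarrow> complex" and crv :: "'a set \<Rightarrow> real \<Rightarrow> complex"
  assumes pos_inj: "inj_on pos V"
    and edge_arc: "\<And>e. e \<in> E \<Longrightarrow> arc (crv e)"
    and edge_ends: "\<And>e. e \<in> E \<Longrightarrow> {pathstart (crv e), pathfinish (crv e)} = pos ` e"
    and edge_vertices: "\<And>e. e \<in> E \<Longrightarrow> path_image (crv e) \<inter> pos ` V = pos ` e"
    and edge_disjoint: "\<And>e e'. e \<in> E \<Longrightarrow> e' \<in> E \<Longrightarrow> e \<noteq> e' \<Longrightarrow>
          path_image (crv e) \<inter> path_image (crv e') = pos ` (e \<inter> e')"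

definition planar_graph :: "'a set \<Rightarrow> 'a set set \<Rightarrow> bool" where
  "planar_graph V E \<longleftrightarrow> simple_graph V E \<and> (\<exists>pos crv. plane_embedding V E pos crv)"

definition drawing ::
  "'a set \<Rightarrow> 'a set set \<Rightarrow> ('a \<Rightarrow> complex) \<Rightarrow> ('a set \<Rightarrow> real \<Rightarrow> complex) \<Rightarrow> complex set" where
  "drawing V E pos crv = pos ` V \<union> (\<Union>e\<in>E. path_image (crv e))"

definition faces ::
  "'a set \<Rightarrow> 'a set set \<Rightarrow> ('a \<Rightarrow> complex) \<Rightarrow> ('a set \<Rightarrow> real \<Rightarrow> complex) \<Rightarrow> complex set set" where
  "faces V E pos crv = components (- drawing V E pos crv)"

definition bounding_cycle ::
  "'a set set \<Rightarrow> ('a set \<Rightarrow> real \<Rightarrow> complex) \<Rightarrow> complex set \<Rightarrow> 'a list \<Rightarrow> bool" where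
  "bounding_cycle E crv F c \<longleftrightarrow>
     elementary_cycle E c \<and> frontier F = (\<Union>e\<in>cycle_edges c. path_image (crv e))"

text \<open>The choice of the bounding cycle is immaterial, and the weight is the number of
  vertices on the border minus two: see \<open>face_weight_eq\<close> below. A face that is not bounded
  by an elementary cycle has no meaningful weight.\<close>

definition face_weight ::
  "'a set set \<Rightarrow> ('a set \<Rightarrow> real \<Rightarrow> complex) \<Rightarrow> complex set \<Rightarrow> int" where
  "face_weight E crv F = int (length (SOME c. bounding_cycle E crv F c)) - 2"

lemma (in plane_embedding) bounding_cycle_vertices:
  assumes "bounding_cycle E crv F c"
  shows "{v \<in> V. pos v \<in> frontier F} = set c"
proof -
  have fr: "frontier F = (\<Union>e\<in>cycle_edges c. path_image (crv e))"
    and sub: "cycle_edges c \<subseteq> E" and len: "3 \<le> length c"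
    using assms by (auto simp: bounding_cycle_def elementary_cycle_def)
  have in_set: "e \<subseteq> set c" if "e \<in> cycle_edges c" for e
  proof -
    have "Suc i mod length c < length c" if "i < length c" for i
      using that by (intro mod_less_divisor) auto
    then show ?thesis using that by (auto simp: cycle_edges_def)
  qed
  show ?thesis
  proof (intro equalityI subsetI)
    fix v assume "v \<in> {v \<in> V. pos v \<in> frontier F}"
    then obtain e where v: "v \<in> V" and e: "e \<in> cycle_edges c" "pos v \<in> path_image (crv e)"
      using fr by auto
    then have "pos v \<in> pos ` e" using edge_vertices[of e] sub by blast
    moreover have "e \<subseteq> V" using edges[of e] e sub by blast
    ultimately have "v \<in> e" using v pos_inj by (meson inj_on_image_mem_iff)
    then show "v \<in> set c" using in_set e by blast
  next
    fix v assume "v \<in> set c"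
    then obtain i where i: "i < length c" "v = c ! i" by (metis in_set_conv_nth)
    let ?e = "{c ! i, c ! (Suc i mod length c)}"
    have e: "?e \<in> cycle_edges c" using i by (auto simp: cycle_edges_def)
    then have E: "?e \<in> E" using sub by blast
    have "v \<in> ?e" using i by simp
    moreover have "v \<in> V" using edges[OF E] i by auto
    moreover have "pos v \<in> path_image (crv ?e)"
      using edge_vertices[OF E] i by blast
    ultimately show "v \<in> {v \<in> V. pos v \<in> frontier F}" using fr e by blast
  qed
qed

lemma (in plane_embedding) face_weight_eq:
  assumes "bounding_cycle E crv F c"
  shows "face_weight E crv F = int (length c) - 2"
    and "face_weight E crv F = int (card {v \<in> V. pos v \<in> frontier F}) - 2"
proof -
  have card: "length c' = card {v \<in> V. pos v \<in> frontier F}" if "bounding_cycle E crv F c'" for c'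
    using bounding_cycle_vertices[OF that] that
    by (simp add: bounding_cycle_def elementary_cycle_def distinct_card)
  have "bounding_cycle E crv F (SOME c. bounding_cycle E crv F c)"
    using assms by (rule someI)
  then show "face_weight E crv F = int (length c) - 2"
    and "face_weight E crv F = int (card {v \<in> V. pos v \<in> frontier F}) - 2"
    using card[OF assms] card by (auto simp: face_weight_def)
qed

section \<open>Isobaric partitions\<close>

definition isobaric_partition ::
  "'a set \<Rightarrow> 'a set set \<Rightarrow> ('a \<Rightarrow> complex) \<Rightarrow> ('a set \<Rightarrow> real \<Rightarrow> complex) \<Rightarrow>
   complex set set \<Rightarrow> complex set set \<Rightarrow> bool" where
  "isobaric_partition V E pos crv A B \<longleftrightarrow>
     A \<union> B = faces V E pos crv \<and> A \<inter> B = {} \<and>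
     (\<Sum>F\<in>A. face_weight E crv F) = (\<Sum>F\<in>B. face_weight E crv F)"

definition partition_border ::
  "'a set set \<Rightarrow> ('a set \<Rightarrow> real \<Rightarrow> complex) \<Rightarrow>
   complex set set \<Rightarrow> complex set set \<Rightarrow> 'a set set" where
  "partition_border E crv A B =
     {e \<in> E. (\<exists>F\<in>A. path_image (crv e) \<subseteq> frontier F) \<and>
             (\<exists>F\<in>B. path_image (crv e) \<subseteq> frontier F)}"

end

theory Submission
  imports Defs "HOL-Complex_Analysis.Winding_Numbers"
begin

text \<open>The Hamiltonian cycle \<open>H\<close> is drawn as a Jordan curve \<open>J\<close>, and the partition is the one
  into the faces inside and the faces outside \<open>J\<close>. Draw the cycle first and then
  insert the remaining edges, the chords, one at a time. With the cycle alone there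
  is one face on each side, of weight \<open>n - 2\<close>, where \<open>n\<close> is the number of vertices. A new
  chord runs inside one face, bounded by a cycle \<open>c\<close> say, and cuts it into two faces, bounded by
  cycles \<open>c1\<close> and \<open>c2\<close> each made of the chord and one of the two parts of \<open>c\<close>. The ends of the
  chord are counted twice, so \<open>length c1 + length c2 = length c + 2\<close>, and subtracting two for each
  cycle leaves the total weight of the face unchanged. Hence both sides keep the
  weight \<open>n - 2\<close> up to the end (\<open>sides_balanced\<close>). Along the way every edge of \<open>H\<close> stays
  on the frontier of a face on either side. A chord cannot be on the border, because the
  faces inside and the faces outside have only points of \<open>J\<close> as common frontier points.

  The topological content is that an arc across a face bounded by a Jordan curve cuts it into
  exactly two faces with the expected frontiers (\<open>theta_split\<close>). For the bounded face this is
  \<open>split_inside_simple_closed_curve\<close>. The unbounded face is reduced to it: if an arc \<open>r\<close> joins two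
  points of the curve \<open>p \<union> q\<close> through its outside, then \<open>q\<close> runs inside \<open>p \<union> r\<close> or \<open>p\<close> runs inside
  \<open>q \<union> r\<close>, and exchanging the roles of the arcs puts the chord inside. That one of the two
  cases occurs follows from the additivity of winding numbers (\<open>theta_outside_cases\<close>).\<close>

section \<open>Theta curves\<close>

text \<open>Jordan curves are handled as two arcs with common ends, both oriented from \<open>a\<close> to \<open>b\<close>: in
  a theta curve each of the three arcs belongs to two of the three Jordan curves, and this
  orientation makes the three pairs interchangeable.\<close>

definition arc_pair where
  "arc_pair p q a b \<longleftrightarrow> arc p \<and> arc q \<and> pathstart p = a \<and> pathfinish p = b \<and>
     pathstart q = a \<and> pathfinish q = b \<and> path_image p \<inter> path_image q = {a, b}"
  for p q :: "real \<Rightarrow> complex"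

lemma arc_pair_commute: "arc_pair p q a b \<Longrightarrow> arc_pair q p a b"
  by (auto simp: arc_pair_def)

lemma arc_pair_loop:
  assumes "arc_pair p q a b"
  shows "simple_path (p +++ reversepath q)"
    and "pathfinish (p +++ reversepath q) = pathstart (p +++ reversepath q)"
    and "path_image (p +++ reversepath q) = path_image p \<union> path_image q"
  using assms by (auto simp: arc_pair_def simple_path_join_loop_eq path_image_join arc_reversepath)

lemma Jordan_arc_pair:
  assumes "arc_pair p q a b"
  shows "inside (path_image p \<union> path_image q) \<noteq> {}"
    and "open (inside (path_image p \<union> path_image q))"
    and "connected (inside (path_image p \<union> path_image q))"
    and "frontier (inside (path_image p \<union> path_image q)) = path_image p \<union> path_image q"
    and "outside (path_image p \<union> path_image q) \<noteq> {}"
    and "open (outside (path_image p \<union> path_image q))"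
    and "connected (outside (path_image p \<union> path_image q))"
    and "frontier (outside (path_image p \<union> path_image q)) = path_image p \<union> path_image q"
  using Jordan_inside_outside[OF arc_pair_loop(1,2)[OF assms]] arc_pair_loop(3)[OF assms] by auto

text \<open>For the loop that follows \<open>p\<close> and returns along \<open>q\<close>, the winding number is a difference of
  one number for each arc. So being outside means equality of these numbers and being inside means
  inequality, which makes the three Jordan curves of a theta curve comparable.\<close>

lemma winding_number_arc_pair:
  assumes "arc_pair p q a b" and z: "z \<notin> path_image p \<union> path_image q"
  shows "winding_number (p +++ reversepath q) z = winding_number p z - winding_number q z"
  using assms by (simp add: arc_pair_def winding_number_join winding_number_reversepath arc_imp_path)

lemma winding_number_arc_pair_inside:
  assumes "arc_pair p q a b" and z: "z \<in> inside (path_image p \<union> path_image q)"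
  shows "winding_number p z \<noteq> winding_number q z"
proof -
  have "norm (winding_number (p +++ reversepath q) z) = 1"
    using simple_closed_path_norm_winding_number_inside[OF arc_pair_loop(1)[OF assms(1)]] z
      arc_pair_loop(3)[OF assms(1)] by simp
  moreover have "z \<notin> path_image p \<union> path_image q"
    using z inside_no_overlap by fast
  ultimately show ?thesis
    using winding_number_arc_pair[OF assms(1)] by auto
qed

lemma winding_number_arc_pair_outside:
  assumes "arc_pair p q a b" and z: "z \<in> outside (path_image p \<union> path_image q)"
  shows "winding_number p z = winding_number q z"
proof -
  have "winding_number (p +++ reversepath q) z = 0"
    using winding_number_zero_in_outside[of "p +++ reversepath q" z] arc_pair_loop[OF assms(1)] z
    by (simp add: simple_path_imp_path)
  moreover have "z \<notin> path_image p \<union> path_image q"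
    using z outside_no_overlap by fast
  ultimately show ?thesis
    using winding_number_arc_pair[OF assms(1)] by auto
qed

lemma connected_inside_or_outside:
  fixes S :: "'a::real_normed_vector set"
  assumes "connected C" "C \<inter> S = {}" "closed S"
  shows "C \<subseteq> inside S \<or> C \<subseteq> outside S"
proof (rule ccontr)
  assume "\<not> ?thesis"
  moreover have "C \<subseteq> inside S \<union> outside S" using assms by auto
  moreover have "inside S \<inter> outside S \<inter> C = {}" by (simp add: inside_Int_outside)
  ultimately show False
    using connectedD[OF assms(1) open_inside[OF assms(3)] open_outside[OF assms(3)]] by blast
qed

lemma closed_arc_pair: "arc_pair p q a b \<Longrightarrow> closed (path_image p \<union> path_image q)"
  by (simp add: arc_pair_def closed_Un closed_arc_image)

lemma arc_pair_open_arc: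
  assumes "arc_pair p q a b"
  shows "connected (path_image p - {a, b})" and "path_image p - {a, b} \<noteq> {}"
  using assms connected_simple_path_endless[of p] nonempty_simple_path_endless[of p]
  by (auto simp: arc_pair_def arc_imp_simple_path)

lemma theta_inside:
  assumes pq: "arc_pair p q a b" and pr: "arc_pair p r a b" and qr: "arc_pair q r a b"
    and r: "path_image r - {a, b} \<subseteq> inside (path_image p \<union> path_image q)"
  shows "inside (path_image p \<union> path_image r) \<inter> inside (path_image q \<union> path_image r) = {}"
    and "inside (path_image p \<union> path_image r) \<union> inside (path_image q \<union> path_image r) =
         inside (path_image p \<union> path_image q) - path_image r"
proof -
  have ne: "path_image r \<inter> inside (path_image p \<union> path_image q) \<noteq> {}"
    using r arc_pair_open_arc(2)[OF arc_pair_commute[OF qr]] by blast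
  have ab: "a \<noteq> b" using pq arc_distinct_ends by (fastforce simp: arc_pair_def)
  have "inside (path_image p \<union> path_image r) \<inter> inside (path_image q \<union> path_image r) = {} \<and>
    inside (path_image p \<union> path_image r) \<union> inside (path_image q \<union> path_image r) \<union>
           (path_image r - {a,b}) = inside (path_image p \<union> path_image q)"
    by (rule split_inside_simple_closed_curve[of p a b q r])
       (use pq pr qr ne ab in \<open>auto simp: arc_pair_def arc_imp_simple_path\<close>)
  moreover have "inside (path_image p \<union> path_image r) \<inter> (path_image p \<union> path_image r) = {}"
    "inside (path_image q \<union> path_image r) \<inter> (path_image q \<union> path_image r) = {}"
    "inside (path_image p \<union> path_image q) \<inter> (path_image p \<union> path_image q) = {}"
    by (rule inside_no_overlap)+
  moreover have "{a,b} \<subseteq> path_image p" using pq by (auto simp: arc_pair_def)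
  ultimately show "inside (path_image p \<union> path_image r) \<inter> inside (path_image q \<union> path_image r) = {}"
    and "inside (path_image p \<union> path_image r) \<union> inside (path_image q \<union> path_image r) =
         inside (path_image p \<union> path_image q) - path_image r"
    by blast+
qed

text \<open>If both cases failed, then each of the three arcs would run outside the Jordan curve formed
  by the other two, so that the inside of one curve would lie outside the other two.
  At a point inside \<open>p \<union> r\<close> the winding numbers of \<open>p\<close> and \<open>r\<close> would then both
  agree with that of \<open>q\<close>, yet differ from each other.\<close>

lemma theta_outside_cases:
  assumes pq: "arc_pair p q a b" and pr: "arc_pair p r a b" and qr: "arc_pair q r a b"
    and r: "path_image r - {a, b} \<subseteq> outside (path_image p \<union> path_image q)"
  shows "path_image q - {a, b} \<subseteq> inside (path_image p \<union> path_image r) \<or>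
         path_image p - {a, b} \<subseteq> inside (path_image q \<union> path_image r)"
proof (rule ccontr)
  assume no: "\<not> ?thesis"
  have disj: "(path_image q - {a, b}) \<inter> (path_image p \<union> path_image r) = {}"
    using pq qr by (auto simp: arc_pair_def)
  then have q: "path_image q - {a, b} \<subseteq> outside (path_image p \<union> path_image r)"
    using no connected_inside_or_outside[OF arc_pair_open_arc(1)[OF arc_pair_commute[OF pq]] disj
        closed_arc_pair[OF pr]] by blast
  have disj: "(path_image p - {a, b}) \<inter> (path_image q \<union> path_image r) = {}"
    using pq pr by (auto simp: arc_pair_def)
  then have p: "path_image p - {a, b} \<subseteq> outside (path_image q \<union> path_image r)"
    using no connected_inside_or_outside[OF arc_pair_open_arc(1)[OF pq] disj
        closed_arc_pair[OF qr]] by blast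
  \<comment> \<open>An inside that avoids another curve is on one side of it; were it the inside, the closure
    would put the arc \<open>y\<close> there too.\<close>
  have key: "inside (path_image x \<union> path_image y) \<subseteq> outside (path_image x \<union> path_image z)"
    if xy: "arc_pair x y a b" and xz: "arc_pair x z a b" 
    and y: "path_image y - {a, b} \<subseteq> outside (path_image x \<union> path_image z)"
    and z: "path_image z - {a, b} \<subseteq> outside (path_image x \<union> path_image y)" for x y z
  proof -
    let ?I = "inside (path_image x \<union> path_image y)"
    have ab: "{a,b} \<subseteq> path_image x" using xy by (auto simp: arc_pair_def)
    have "?I \<inter> (path_image x \<union> path_image z) = {}"
      using z ab inside_no_overlap[of "path_image x \<union> path_image y"]
        inside_Int_outside[of "path_image x \<union> path_image y"] by blast
    then consider "?I \<subseteq> inside (path_image x \<union> path_image z)"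
      | "?I \<subseteq> outside (path_image x \<union> path_image z)"
      using connected_inside_or_outside[OF Jordan_arc_pair(3)[OF xy] _ closed_arc_pair[OF xz]]
      by blast
    then show ?thesis
    proof cases
      case 1
      have "path_image y \<subseteq> closure ?I"
        using Jordan_arc_pair(4)[OF xy] by (auto simp: frontier_def)
      also have "\<dots> \<subseteq> closure (inside (path_image x \<union> path_image z))"
        using 1 by (rule closure_mono)
      also have "\<dots> = inside (path_image x \<union> path_image z) \<union> (path_image x \<union> path_image z)"
        using Jordan_arc_pair(4)[OF xz] by (simp add: closure_Un_frontier)
      finally have "path_image y - {a, b} = {}"
        using y inside_Int_outside[of "path_image x \<union> path_image z"]
          outside_no_overlap[of "path_image x \<union> path_image z"] by blast
      then show ?thesis
        using arc_pair_open_arc(2)[OF arc_pair_commute[OF xy]] by simp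
    qed auto
  qed
  obtain z where z: "z \<in> inside (path_image p \<union> path_image r)"
    using Jordan_arc_pair(1)[OF pr] by blast
  have "z \<in> outside (path_image p \<union> path_image q)"
    using key[OF pr pq r q] z by blast
  moreover have "z \<in> outside (path_image r \<union> path_image q)"
    using key[OF arc_pair_commute[OF pr] arc_pair_commute[OF qr]] z p q
    by (simp add: Un_commute subset_iff)
  ultimately show False
    using winding_number_arc_pair_inside[OF pr z] winding_number_arc_pair_outside[OF pq]
      winding_number_arc_pair_outside[OF arc_pair_commute[OF qr]] by metis
qed

definition splits_into where
  "splits_into F r P Q F1 F2 \<longleftrightarrow> F1 \<inter> F2 = {} \<and> F1 \<union> F2 = F - r \<and>
     F1 \<noteq> {} \<and> F2 \<noteq> {} \<and> open F1 \<and> open F2 \<and> connected F1 \<and> connected F2 \<and>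
     frontier F1 = P \<and> frontier F2 = Q"
  for F :: "complex set"

lemma splits_into_commute: "splits_into F r P Q F1 F2 \<Longrightarrow> splits_into F r Q P F2 F1"
  unfolding splits_into_def by blast

text \<open>Here \<open>q\<close> is a chord of the inside of \<open>p \<union> r\<close>, so that inside is made up of
  the inside of \<open>p \<union> q\<close>, the inside of \<open>q \<union> r\<close> and \<open>q\<close> itself. Hence the
  complement of the theta curve consists of these two insides and the outside of \<open>p \<union> r\<close>, and
  the parts other than the inside of \<open>p \<union> q\<close> make up the outside of \<open>p \<union> q\<close> without \<open>r\<close>.\<close>

lemma theta_split_outside:
  assumes pq: "arc_pair p q a b" and pr: "arc_pair p r a b" and qr: "arc_pair q r a b"
    and r: "path_image r - {a, b} \<subseteq> outside (path_image p \<union> path_image q)"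
    and q: "path_image q - {a, b} \<subseteq> inside (path_image p \<union> path_image r)"
  shows "splits_into (outside (path_image p \<union> path_image q)) (path_image r)
     (path_image p \<union> path_image r) (path_image q \<union> path_image r)
     (outside (path_image p \<union> path_image r)) (inside (path_image q \<union> path_image r))"
proof -
  note th = theta_inside[OF pr pq arc_pair_commute[OF qr] q]
  have out: "outside S = - S - inside S" for S :: "complex set" by (auto simp: outside_inside)
  have ab: "{a,b} \<subseteq> path_image p" using pq by (auto simp: arc_pair_def)
  have no: "x \<notin> S" if "x \<in> inside S" for x and S :: "complex set"
    using that inside_no_overlap by fast
  have disj: "outside (path_image p \<union> path_image r) \<inter> inside (path_image q \<union> path_image r) = {}"
    using th unfolding out by (auto simp: Un_commute)
  have "x \<in> outside (path_image p \<union> path_image r) \<union> inside (path_image q \<union> path_image r) \<longleftrightarrow>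
    x \<in> outside (path_image p \<union> path_image q) - path_image r" for x
    using th[THEN eqset_imp_iff, of x] subsetD[OF q, of x] subsetD[OF ab, of x]
      no[of x "path_image p \<union> path_image r"] no[of x "path_image q \<union> path_image r"]
      no[of x "path_image p \<union> path_image q"]
    unfolding out Un_commute[of "path_image r" "path_image q"] by auto
  then have "outside (path_image p \<union> path_image r) \<union> inside (path_image q \<union> path_image r) =
    outside (path_image p \<union> path_image q) - path_image r"
    by blast
  with disj show ?thesis
    unfolding splits_into_def using Jordan_arc_pair[OF pr] Jordan_arc_pair[OF qr] by (intro conjI)
qed

lemma Jordan_arc_pair_components:
  assumes "arc_pair p q a b"
  shows "components (- (path_image p \<union> path_image q)) =
    {inside (path_image p \<union> path_image q), outside (path_image p \<union> path_image q)}"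
  using Jordan_arc_pair[OF assms]
  by (intro components_open_unique) (auto simp: pairwise_insert disjnt_def Int_commute)

lemma theta_split:
  assumes pq: "arc_pair p q a b" and pr: "arc_pair p r a b" and qr: "arc_pair q r a b"
    and F: "F \<in> components (- (path_image p \<union> path_image q))"
    and r: "path_image r - {a, b} \<subseteq> F"
  obtains F1 F2 where
    "splits_into F (path_image r) (path_image p \<union> path_image r) (path_image q \<union> path_image r) F1 F2"
proof -
  from F Jordan_arc_pair_components[OF pq]
  consider "F = inside (path_image p \<union> path_image q)" | "F = outside (path_image p \<union> path_image q)"
    by blast
  then show thesis
  proof cases
    case 1
    then show thesis
      using that[of "inside (path_image p \<union> path_image r)" "inside (path_image q \<union> path_image r)"]
        theta_inside[OF pq pr qr] r Jordan_arc_pair[OF pr] Jordan_arc_pair[OF qr]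
      unfolding splits_into_def by blast
  next
    case 2
    with theta_outside_cases[OF pq pr qr] r
    consider "path_image q - {a, b} \<subseteq> inside (path_image p \<union> path_image r)"
      | "path_image p - {a, b} \<subseteq> inside (path_image q \<union> path_image r)" by blast
    then show thesis
    proof cases
      case 1
      then show thesis using that theta_split_outside[OF pq pr qr _ 1] 2 r by blast
    next
      case i: 2
      have "path_image r - {a, b} \<subseteq> outside (path_image q \<union> path_image p)"
        using 2 r by (simp add: Un_commute)
      from splits_into_commute[OF theta_split_outside[OF arc_pair_commute[OF pq] qr pr this i]]
      show thesis using that 2 by (simp add: Un_commute)
    qed
  qed
qed

lemma arc_subset_closure_open_arc:
  assumes "arc g"
  shows "path_image g \<subseteq> closure (path_image g - {pathstart g, pathfinish g})"
proof -
  have "continuous_on (closure {0<..<1::real}) g"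
    using assms by (simp add: arc_def path_def)
  then have "g ` closure {0<..<1} \<subseteq> closure (g ` {0<..<1})"
    by (intro image_closure_subset closed_closure closure_subset)
  then show ?thesis
    using simple_path_endless[OF arc_imp_simple_path[OF assms]] by (simp add: path_image_def)
qed

section \<open>Edges of walks and cycles\<close>

fun walk_edges :: "'a list \<Rightarrow> 'a set set" where
  "walk_edges (u # v # p) = insert {u, v} (walk_edges (v # p))"
| "walk_edges _ = {}"

lemma walk_edges_append:
  "walk_edges (p @ u # q) = walk_edges (p @ [u]) \<union> walk_edges (u # q)"
proof (induction p)
  case (Cons a p)
  then show ?case by (cases p) auto
qed simp

lemma walk_edges_snoc2: "walk_edges (p @ [u, v]) = insert {u, v} (walk_edges (p @ [u]))"
  using walk_edges_append[of p u "[v]"] by auto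

lemma walk_edges_rev: "walk_edges (rev p) = walk_edges p"
  by (induction p rule: walk_edges.induct) (auto simp: walk_edges_snoc2 insert_commute)

lemma Union_walk_edges: "2 \<le> length p \<Longrightarrow> \<Union> (walk_edges p) = set p"
proof (induction p rule: walk_edges.induct)
  case (1 u v p)
  then show ?case by (cases p) auto
qed auto

lemma Union_walk_edges_subset: "\<Union> (walk_edges p) \<subseteq> set p"
  by (induction p rule: walk_edges.induct) auto

lemma walk_edges_conv_nth: "walk_edges p = {{p ! i, p ! Suc i} | i. Suc i < length p}"
proof (induction p rule: walk_edges.induct)
  case (1 u v p)
  have "{{(u # v # p) ! i, (u # v # p) ! Suc i} | i. Suc i < length (u # v # p)} =
    insert {u, v} {{(v # p) ! i, (v # p) ! Suc i} | i. Suc i < length (v # p)}" (is "?L = ?R")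
  proof (intro equalityI subsetI)
    fix e assume "e \<in> ?L"
    then obtain i where "Suc i < length (u # v # p)" "e = {(u # v # p) ! i, (u # v # p) ! Suc i}"
      by blast
    then show "e \<in> ?R" by (cases i) auto
  next
    fix e assume "e \<in> ?R"
    then consider "e = {u, v}"
      | i where "Suc i < length (v # p)" "e = {(v # p) ! i, (v # p) ! Suc i}" by blast
    then show "e \<in> ?L"
    proof cases
      case 1
      then show ?thesis by (intro CollectI exI[of _ 0]) simp
    next
      case (2 i)
      then show ?thesis by (intro CollectI exI[of _ "Suc i"]) simp
    qed
  qed
  with 1 show ?case by simp
qed auto

lemma cycle_edges_eq_walk_edges: "cycle_edges (u # p) = walk_edges (u # p @ [u])"
proof -
  have "(u # p @ [u]) ! Suc i = (u # p) ! (Suc i mod length (u # p))"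
    and "(u # p @ [u]) ! i = (u # p) ! i" if "i < length (u # p)" for i
  proof -
    show "(u # p @ [u]) ! i = (u # p) ! i"
      using that by (metis append_Cons nth_append)
    show "(u # p @ [u]) ! Suc i = (u # p) ! (Suc i mod length (u # p))"
      using that by (cases "i = length p") (auto simp: nth_append)
  qed
  moreover have "Suc i < length (u # p @ [u]) \<longleftrightarrow> i < length (u # p)" for i by simp
  ultimately show ?thesis
    unfolding cycle_edges_def walk_edges_conv_nth by (intro Collect_cong) metis
qed

lemma cycle_edges_rotate: "cycle_edges (p @ u # q) = cycle_edges (u # q @ p)"
proof (cases p)
  case (Cons a p')
  then show ?thesis
    using walk_edges_append[of "a # p'" u "q @ [a]"] walk_edges_append[of "u # q" a "p' @ [u]"]
    by (auto simp: cycle_edges_eq_walk_edges)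
qed simp

lemma cycle_edges_two_walks:
  "cycle_edges (u # p @ v # q) = walk_edges (u # p @ [v]) \<union> walk_edges (u # rev q @ [v])"
  using walk_edges_append[of "u # p" v "q @ [u]"] walk_edges_rev[of "v # q @ [u]"]
  by (simp add: cycle_edges_eq_walk_edges)

lemma cycle_edges_close_walk:
  "cycle_edges (u # p @ [v]) = walk_edges (u # p @ [v]) \<union> {{u, v}}"
  using cycle_edges_two_walks[of u p v "[]"] by simp

lemma Union_cycle_edges: "c \<noteq> [] \<Longrightarrow> \<Union> (cycle_edges c) = set c"
  using Union_walk_edges[of "hd c # tl c @ [hd c]"] cycle_edges_eq_walk_edges[of "hd c" "tl c"]
  by (cases c) auto

text \<open>A chord of a cycle splits it into two walks from \<open>u\<close> to \<open>v\<close>. Rotating the cycle to start at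
  \<open>u\<close> makes them visible in the list without changing its edges or its length.\<close>

lemma elementary_cycle_through:
  assumes "elementary_cycle E c" "u \<in> set c" "v \<in> set c" "u \<noteq> v"
  obtains p q where "elementary_cycle E (u # p @ v # q)"
    "cycle_edges (u # p @ v # q) = cycle_edges c" "length c = length (u # p @ v # q)"
proof -
  obtain xs ys where c: "c = xs @ u # ys"
    using assms(2) split_list by metis
  with assms have "v \<in> set (ys @ xs)" by auto
  then obtain p q where pq: "ys @ xs = p @ v # q"
    using split_list by metis
  have len: "length c = length (u # p @ v # q)"
    using arg_cong[OF pq, of length] c by simp
  have dist: "distinct (u # ys @ xs)"
    using assms(1) c by (auto simp: elementary_cycle_def)
  have eq: "cycle_edges (u # p @ v # q) = cycle_edges c"
    using cycle_edges_rotate[of xs u ys] c pq by simp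
  show thesis
    using that[OF _ eq len] assms(1) dist eq len unfolding elementary_cycle_def pq by metis
qed

lemma chord_notin_walk_edges:
  assumes "distinct (u # p @ [v])" "p \<noteq> []"
  shows "{u, v} \<notin> walk_edges (u # p @ [v])"
proof -
  obtain a q where p: "p = a # q" using assms(2) by (cases p) auto
  have "u \<notin> \<Union> (walk_edges (a # q @ [v]))"
    using Union_walk_edges_subset[of "a # q @ [v]"] assms(1) p by auto
  then show ?thesis using assms(1) p by (auto simp: doubleton_eq_iff)
qed

section \<open>Drawings of walks and cycles\<close>

context plane_embedding
begin

definition drawn :: "'a set set \<Rightarrow> complex set" where
  "drawn S = (\<Union>e\<in>S. path_image (crv e))"

lemma drawn_Un: "drawn (S \<union> T) = drawn S \<union> drawn T"
  by (auto simp: drawn_def)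

lemma drawn_insert: "drawn (insert e S) = path_image (crv e) \<union> drawn S"
  by (auto simp: drawn_def)

lemma finite_edges: "finite E"
  using finite_vertices edges by (intro finite_subset[of E "Pow V"]) auto

lemma pos_in_edge: "e \<in> E \<Longrightarrow> v \<in> e \<Longrightarrow> pos v \<in> path_image (crv e)"
  using edge_vertices[of e] by blast

lemma closed_drawn: "S \<subseteq> E \<Longrightarrow> closed (drawn S)"
  unfolding drawn_def using finite_subset[OF _ finite_edges] edge_arc
  by (intro closed_UN ballI closed_arc_image) auto

text \<open>Disjoint sets of edges meet in the plane only in common vertices. All disjointness conditions
  on arcs are reduced to combinatorics by this lemma.\<close>

lemma drawn_Int:
  assumes "S \<subseteq> E" "T \<subseteq> E" "S \<inter> T = {}"
  shows "drawn S \<inter> drawn T = pos ` (\<Union>S \<inter> \<Union>T)"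
proof (intro equalityI subsetI)
  fix x assume "x \<in> drawn S \<inter> drawn T"
  then obtain e f where ef: "e \<in> S" "f \<in> T" "x \<in> path_image (crv e) \<inter> path_image (crv f)"
    by (auto simp: drawn_def)
  with edge_disjoint[of e f] assms have "x \<in> pos ` (e \<inter> f)" by blast
  with ef show "x \<in> pos ` (\<Union>S \<inter> \<Union>T)" by blast
next
  fix x assume "x \<in> pos ` (\<Union>S \<inter> \<Union>T)"
  then obtain v e f where "x = pos v" "e \<in> S" "v \<in> e" "f \<in> T" "v \<in> f" by blast
  with pos_in_edge[of e v] pos_in_edge[of f v] assms show "x \<in> drawn S \<inter> drawn T"
    unfolding drawn_def by blast
qed

lemma pos_in_drawn: "S \<subseteq> E \<Longrightarrow> v \<in> \<Union>S \<Longrightarrow> pos v \<in> drawn S"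
  unfolding drawn_def using pos_in_edge by blast

lemma walk_arc_exists:
  assumes "2 \<le> length p" "distinct p" "walk_edges p \<subseteq> E"
  shows "\<exists>g. arc g \<and> pathstart g = pos (hd p) \<and> pathfinish g = pos (last p) \<and>
    path_image g = drawn (walk_edges p)"
  using assms
proof (induction p rule: walk_edges.induct)
  case (1 u v p)
  have E: "{u, v} \<in> E" using 1 by simp
  have "\<exists>f. arc f \<and> pathstart f = pos u \<and> pathfinish f = pos v \<and>
      path_image f = path_image (crv {u, v})"
  proof -
    consider "pathstart (crv {u, v}) = pos u" "pathfinish (crv {u, v}) = pos v"
      | "pathstart (crv {u, v}) = pos v" "pathfinish (crv {u, v}) = pos u"
      using edge_ends[OF E] by (auto simp: doubleton_eq_iff)
    then show ?thesis
    proof cases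
      case 1 then show ?thesis using edge_arc[OF E] by blast
    next
      case 2 then show ?thesis
        using edge_arc[OF E] by (intro exI[of _ "reversepath (crv {u, v})"]) (simp add: arc_reversepath)
    qed
  qed
  then obtain f where f: "arc f" "pathstart f = pos u" "pathfinish f = pos v"
      "path_image f = path_image (crv {u, v})" by blast
  show ?case
  proof (cases "p = []")
    case True
    with f show ?thesis by (auto simp: drawn_def)
  next
    case False
    then have "2 \<le> length (v # p)" by (cases p) auto
    with 1 obtain g where g: "arc g" "pathstart g = pos v" "pathfinish g = pos (last p)"
      "path_image g = drawn (walk_edges (v # p))"
      using False by auto
    have U: "\<Union> (walk_edges (v # p)) = set (v # p)"
      using \<open>2 \<le> length (v # p)\<close> by (rule Union_walk_edges)
    then have "{{u, v}} \<inter> walk_edges (v # p) = {}"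
      using 1 by auto
    then have "path_image f \<inter> path_image g = pos ` ({u, v} \<inter> set (v # p))"
      using drawn_Int[of "{{u, v}}" "walk_edges (v # p)"] 1 f g U by (simp add: drawn_def)
    then have "path_image f \<inter> path_image g \<subseteq> {pathstart g}"
      using 1 g by auto
    then show ?thesis
      using f g False by (intro exI[of _ "f +++ g"])
        (auto simp: arc_join path_image_join drawn_def)
  qed
qed auto

definition walk_arc where
  "walk_arc u p v g \<longleftrightarrow> distinct (u # p @ [v]) \<and> walk_edges (u # p @ [v]) \<subseteq> E \<and>
     arc g \<and> pathstart g = pos u \<and> pathfinish g = pos v \<and>
     path_image g = drawn (walk_edges (u # p @ [v]))"

lemma walk_arc_obtain:
  assumes "distinct (u # p @ [v])" "walk_edges (u # p @ [v]) \<subseteq> E"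
  obtains g where "walk_arc u p v g"
  using walk_arc_exists[of "u # p @ [v]"] assms unfolding walk_arc_def by auto

text \<open>The hypothesis on \<open>{u, v}\<close> rules out that both walks consist of the same single edge.\<close>

lemma walk_arcs_pair:
  assumes g: "walk_arc u p v g" and h: "walk_arc u q v h"
    and "set p \<inter> set q = {}" and uv: "{u, v} \<notin> walk_edges (u # p @ [v])"
  shows "arc_pair g h (pos u) (pos v)"
proof -
  let ?S = "walk_edges (u # p @ [v])" and ?T = "walk_edges (u # q @ [v])"
  have S: "\<Union>?S = set (u # p @ [v])" and T: "\<Union>?T = set (u # q @ [v])"
    by (rule Union_walk_edges; simp)+
  have int: "\<Union>?S \<inter> \<Union>?T = {u, v}"
    using S T assms(3) g h by (auto simp: walk_arc_def)
  have "?S \<inter> ?T = {}"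
  proof (rule ccontr)
    assume "?S \<inter> ?T \<noteq> {}"
    then obtain e where e: "e \<in> ?S" "e \<in> ?T" by blast
    then have "e \<subseteq> {u, v}" "card e = 2" using int edges[of e] g by (auto simp: walk_arc_def)
    then have "e = {u, v}"
      using g card_subset_eq[of "{u, v}" e] by (simp add: walk_arc_def)
    with e uv show False by simp
  qed
  then have "path_image g \<inter> path_image h = {pos u, pos v}"
    using drawn_Int[of ?S ?T] int g h by (simp add: walk_arc_def)
  then show ?thesis using g h by (simp add: arc_pair_def walk_arc_def)
qed

text \<open>If a connected set avoiding the frontier of \<open>F\<close> meets \<open>F\<close>, it is contained in \<open>F\<close>. Hence a face of
  the whole drawing is already a face of the drawing of its bounding cycle, where \<open>theta_split\<close>
  applies.\<close>

lemma component_of_frontier: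
  assumes "F \<in> components (- X)" "frontier F \<subseteq> X"
  shows "F \<in> components (- frontier F)"
proof -
  have F: "F \<noteq> {}" "connected F" "F \<subseteq> - frontier F"
    using assms in_components_nonempty in_components_connected in_components_subset by blast+
  have "C = F" if "C \<noteq> {}" "F \<subseteq> C" "C \<subseteq> - frontier F" "connected C" for C
    using connected_Int_frontier[of C F] that F by blast
  with F show ?thesis unfolding in_components_maximal by blast
qed

text \<open>An edge that is covered by a drawing belongs to it, as its interior points lie on no
  other edge. In particular the frontier of a face determines the edges of its bounding cycle.\<close>

lemma edge_subset_drawn:
  assumes "e \<in> E" "S \<subseteq> E" "path_image (crv e) \<subseteq> drawn S"
  shows "e \<in> S"
proof (rule ccontr)
  assume "e \<notin> S"
  then have "path_image (crv e) \<inter> drawn S \<subseteq> {pathstart (crv e), pathfinish (crv e)}"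
    using drawn_Int[of "{e}" S] assms edge_ends[of e] by (auto simp: drawn_def)
  then show False
    using nonempty_simple_path_endless[OF arc_imp_simple_path[OF edge_arc[OF assms(1)]]] assms(3)
    by blast
qed

lemma bounding_cycle_eq:
  "bounding_cycle E crv F c \<longleftrightarrow> elementary_cycle E c \<and> frontier F = drawn (cycle_edges c)"
  by (simp add: bounding_cycle_def drawn_def)

lemma bounding_cycle_edges:
  assumes "bounding_cycle E crv F c"
  shows "e \<in> cycle_edges c \<longleftrightarrow> e \<in> E \<and> path_image (crv e) \<subseteq> frontier F"
proof -
  have "cycle_edges c \<subseteq> E" "frontier F = drawn (cycle_edges c)"
    using assms by (auto simp: bounding_cycle_eq elementary_cycle_def)
  then show ?thesis using edge_subset_drawn[of e "cycle_edges c"] by (auto simp: drawn_def)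
qed

lemma elementary_cycle_arc_pair:
  assumes "elementary_cycle E c"
  obtains g h a b where "arc_pair g h a b" "drawn (cycle_edges c) = path_image g \<union> path_image h"
proof -
  obtain u v w q where c: "c = u # v # w # q"
    using assms by (metis elementary_cycle_def Suc_le_length_iff numeral_3_eq_3)
  define r where "r = rev (w # q)"
  have eq: "cycle_edges c = walk_edges (u # [] @ [v]) \<union> walk_edges (u # r @ [v])"
    using cycle_edges_two_walks[of u "[]" v "w # q"] c by (simp add: r_def)
  have r: "distinct (u # r @ [v])" "r \<noteq> []" and uv: "distinct (u # [] @ [v])"
    using assms c by (auto simp: elementary_cycle_def r_def)
  have E: "walk_edges (u # r @ [v]) \<subseteq> E" "walk_edges (u # [] @ [v]) \<subseteq> E"
    using assms eq by (auto simp: elementary_cycle_def)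
  obtain g where g: "walk_arc u r v g" using walk_arc_obtain[OF r(1) E(1)] .
  obtain h where h: "walk_arc u [] v h" using walk_arc_obtain[OF uv E(2)] .
  have "arc_pair g h (pos u) (pos v)"
    using walk_arcs_pair[OF g h] chord_notin_walk_edges[OF r] by simp
  moreover have "drawn (cycle_edges c) = path_image g \<union> path_image h"
    unfolding eq drawn_Un using g h unfolding walk_arc_def by auto
  ultimately show thesis using that by blast
qed

end

section \<open>Inserting the chords of a Hamiltonian cycle\<close>

context plane_embedding
begin

text \<open>The bounding cycles are required to lie in \<open>S\<close>: it is this that makes a chord outside \<open>S\<close> differ
  from all their edges.\<close>

definition cycle_faces where
  "cycle_faces S \<longleftrightarrow>
     (\<forall>F\<in>components (- drawn S). \<exists>c. bounding_cycle E crv F c \<and> cycle_edges c \<subseteq> S)"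

lemma components_split:
  assumes S: "S \<subseteq> E" and e: "e \<in> E" "e \<subseteq> \<Union>S"
    and F: "F \<in> components (- drawn S)" and sub: "path_image (crv e) - pos ` e \<subseteq> F"
    and split: "splits_into F (path_image (crv e)) P Q F1 F2"
  shows "components (- drawn (insert e S)) = components (- drawn S) - {F} \<union> {F1, F2}"
proof (rule components_open_unique)
  note sp = split[unfolded splits_into_def]
  let ?C = "components (- drawn S)"
  have ends: "pos ` e \<subseteq> drawn S" using pos_in_drawn[OF S] e(2) by blast
  have disj: "X \<inter> Y = {}" if "X \<in> ?C" "Y \<in> ?C" "X \<noteq> Y" for X Y
    using that pairwise_disjoint_components[of "- drawn S"] by (auto simp: pairwise_def)
  have parts: "F1 \<inter> F2 = {}" "F1 \<subseteq> F" "F2 \<subseteq> F" "F1 \<union> F2 = F - path_image (crv e)"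
    using sp by blast+
  have old: "X \<inter> F1 = {}" "X \<inter> F2 = {}" if "X \<in> ?C - {F}" for X
    using that disj[OF _ F, of X] parts(2,3) by auto
  show "pairwise disjnt (?C - {F} \<union> {F1, F2})"
    unfolding pairwise_def disjnt_def
  proof (intro ballI impI)
    fix X Y assume "X \<in> ?C - {F} \<union> {F1, F2}" "Y \<in> ?C - {F} \<union> {F1, F2}" "X \<noteq> Y"
    then consider "X \<in> ?C - {F}" "Y \<in> ?C - {F}" | "X \<in> ?C - {F}" "Y \<in> {F1, F2}"
      | "X \<in> {F1, F2}" "Y \<in> ?C - {F}" | "X \<in> {F1, F2}" "Y \<in> {F1, F2}" by blast
    then show "X \<inter> Y = {}"
    proof cases
      case 1 then show ?thesis using disj[of X Y] \<open>X \<noteq> Y\<close> by simp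
    next
      case 2 then show ?thesis using old[of X] by auto
    next
      case 3 then show ?thesis using old[of Y] by auto
    next
      case 4 then show ?thesis using parts(1) \<open>X \<noteq> Y\<close> by auto
    qed
  qed
  have rest: "\<Union>(?C - {F}) = - drawn S - F"
    using in_components_unions_complement[OF F] by simp
  have FS: "F \<subseteq> - drawn S" using F by (rule in_components_subset)
  have "\<Union>(?C - {F} \<union> {F1, F2}) = (- drawn S - F) \<union> (F - path_image (crv e))"
    using rest parts(4) by auto
  also have "\<dots> = - (path_image (crv e) \<union> drawn S)"
    using FS sub ends by blast
  finally show "\<Union>(?C - {F} \<union> {F1, F2}) = - drawn (insert e S)"
    by (simp only: drawn_insert)
  show "open X \<and> connected X \<and> X \<noteq> {}" if "X \<in> ?C - {F} \<union> {F1, F2}" for X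
    using that sp in_components_connected in_components_nonempty closed_drawn[OF S]
      open_components[of "- drawn S" X] by blast
qed

text \<open>The induction step of the proof. The weight equation holds because the bounding cycle
  of \<open>F\<close> is cut at the ends of the chord, and these two vertices are shared by the new cycles.\<close>

lemma add_chord:
  assumes S: "S \<subseteq> E" "cycle_faces S" and e: "e \<in> E" "e \<notin> S" "e \<subseteq> \<Union>S"
  obtains F F1 F2 where "F \<in> components (- drawn S)"
    "components (- drawn (insert e S)) = components (- drawn S) - {F} \<union> {F1, F2}"
    "F1 \<notin> components (- drawn S)" "F2 \<notin> components (- drawn S)" "F1 \<noteq> F2"
    "F1 \<subseteq> F" "F2 \<subseteq> F" "F1 \<noteq> {}" "F2 \<noteq> {}" "cycle_faces (insert e S)"
    "face_weight E crv F = face_weight E crv F1 + face_weight E crv F2"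
    "\<And>f. f \<in> E \<Longrightarrow> path_image (crv f) \<subseteq> frontier F \<Longrightarrow>
       path_image (crv f) \<subseteq> frontier F1 \<or> path_image (crv f) \<subseteq> frontier F2"
proof -
  let ?C = "components (- drawn S)"
  let ?r = "path_image (crv e)"
  obtain u v where uv: "e = {u, v}" "u \<noteq> v"
    using edges[OF e(1)] card_2_iff by metis
  have ends: "{pathstart (crv e), pathfinish (crv e)} = pos ` e" by (rule edge_ends[OF e(1)])
  have "?r \<inter> drawn S = pos ` (e \<inter> \<Union>S)"
    using drawn_Int[of "{e}" S] S e by (simp add: drawn_def)
  then have disj: "?r - pos ` e \<subseteq> - drawn S" by blast
  have "connected (?r - pos ` e)" "?r - pos ` e \<noteq> {}"
    using connected_simple_path_endless nonempty_simple_path_endless arc_imp_simple_path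
      edge_arc[OF e(1)] ends by metis+
  then obtain F where F: "F \<in> ?C" "?r - pos ` e \<subseteq> F"
    using exists_component_superset[OF disj] disj by blast
  obtain c where c: "bounding_cycle E crv F c" "cycle_edges c \<subseteq> S"
    using S(2) F(1) by (auto simp: cycle_faces_def)
  \<comment> \<open>The ends of the chord are limits of points of \<open>F\<close> but lie on the drawing.\<close>
  have "pos w \<in> frontier F" if "w \<in> e" for w
  proof -
    have "pos w \<in> closure (?r - pos ` e)"
      using arc_subset_closure_open_arc[OF edge_arc[OF e(1)]] ends pos_in_edge[OF e(1) that] by auto
    then have "pos w \<in> closure F" using closure_mono[OF F(2)] by blast
    moreover have "pos w \<notin> F"
      using pos_in_drawn[OF S(1)] that e(3) in_components_subset[OF F(1)] by blast
    moreover have "interior F \<subseteq> F" by (rule interior_subset)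
    ultimately show ?thesis by (auto simp: frontier_def)
  qed
  then have "u \<in> set c" "v \<in> set c"
    using bounding_cycle_vertices[OF c(1)] edges[OF e(1)] uv by auto
  then obtain p q where pq: "elementary_cycle E (u # p @ v # q)"
      "cycle_edges (u # p @ v # q) = cycle_edges c" "length c = length (u # p @ v # q)"
    using elementary_cycle_through[of E c u v] c(1) uv(2) by (auto simp: bounding_cycle_def)
  define q' where "q' = rev q"
  have cyc: "cycle_edges c = walk_edges (u # p @ [v]) \<union> walk_edges (u # q' @ [v])"
    using cycle_edges_two_walks[of u p v q] pq(2) by (simp add: q'_def)
  \<comment> \<open>As the chord is new, both parts of the cycle have inner vertices, so the new cycles have
    length at least three.\<close>
  have notin: "{u, v} \<notin> walk_edges (u # p @ [v])" "{u, v} \<notin> walk_edges (u # q' @ [v])"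
    using c(2) cyc e(2) uv(1) by auto
  have sub: "walk_edges (u # p @ [v]) \<subseteq> E" "walk_edges (u # q' @ [v]) \<subseteq> E"
      "walk_edges (u # [] @ [v]) \<subseteq> E"
    using cyc c(2) S(1) e(1) uv(1) by auto
  have dist: "distinct (u # p @ [v])" "distinct (u # q' @ [v])" "distinct (u # [] @ [v])"
      "set p \<inter> set q' = {}"
    using pq(1) by (auto simp: elementary_cycle_def q'_def)
  obtain g where g: "walk_arc u p v g" using walk_arc_obtain[OF dist(1) sub(1)] .
  obtain h where h: "walk_arc u q' v h" using walk_arc_obtain[OF dist(2) sub(2)] .
  obtain k where k: "walk_arc u [] v k" using walk_arc_obtain[OF dist(3) sub(3)] .
  have kr: "path_image k = ?r" using k uv by (simp add: walk_arc_def drawn_def)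
  have frF: "frontier F = path_image g \<union> path_image h"
    using c(1) cyc g h by (simp add: bounding_cycle_eq walk_arc_def drawn_Un)
  have FS: "frontier F \<subseteq> drawn S"
    using c by (auto simp: bounding_cycle_eq drawn_def)
  have "F \<in> components (- (path_image g \<union> path_image h))"
    using component_of_frontier[OF F(1) FS] frF by simp
  moreover have "path_image k - {pos u, pos v} \<subseteq> F"
    using F(2) kr uv by simp
  moreover have "arc_pair g h (pos u) (pos v)" "arc_pair g k (pos u) (pos v)"
      "arc_pair h k (pos u) (pos v)"
    using walk_arcs_pair[OF g h] walk_arcs_pair[OF g k] walk_arcs_pair[OF h k] dist(4) notin by auto
  ultimately obtain F1 F2 where split:
    "splits_into F (path_image k) (path_image g \<union> path_image k) (path_image h \<union> path_image k) F1 F2"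
    using theta_split by blast
  note sp = split[unfolded splits_into_def]
  have "p \<noteq> []" "q' \<noteq> []" using notin by auto
  then have el: "elementary_cycle E (u # p @ [v])" "elementary_cycle E (u # q' @ [v])"
    using dist sub e(1) uv(1)
    by (cases p; cases q'; simp add: elementary_cycle_def cycle_edges_close_walk[of _ "_ # _", simplified])+
  have cc: "cycle_edges (u # p @ [v]) = walk_edges (u # p @ [v]) \<union> {e}"
     "cycle_edges (u # q' @ [v]) = walk_edges (u # q' @ [v]) \<union> {e}"
    using cycle_edges_close_walk uv(1) by metis+
  have b1: "bounding_cycle E crv F1 (u # p @ [v])" and b2: "bounding_cycle E crv F2 (u # q' @ [v])"
    unfolding bounding_cycle_eq cc using el sp g h kr by (auto simp: walk_arc_def drawn_Un drawn_insert Un_commute drawn_def)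
  have comps: "components (- drawn (insert e S)) = ?C - {F} \<union> {F1, F2}"
    using components_split[OF S(1) e(1,3) F] split kr by metis
  have parts: "F1 \<inter> F2 = {}" "F1 \<subseteq> F" "F2 \<subseteq> F" "F1 \<noteq> {}" "F2 \<noteq> {}"
    using sp by blast+
  have new: "F1 \<notin> ?C" "F2 \<notin> ?C"
    using parts F(1) components_nonoverlap[of _ "- drawn S" F] by (metis inf.absorb1 inf.absorb2 inf_commute)+
  show thesis
  proof (rule that[OF F(1) comps new])
    show "F1 \<noteq> F2" "F1 \<subseteq> F" "F2 \<subseteq> F" "F1 \<noteq> {}" "F2 \<noteq> {}" using parts by auto
    show "cycle_faces (insert e S)"
      unfolding cycle_faces_def comps
    proof
      fix X assume "X \<in> ?C - {F} \<union> {F1, F2}"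
      then consider "X \<in> ?C" | "X = F1" | "X = F2" by blast
      then show "\<exists>c. bounding_cycle E crv X c \<and> cycle_edges c \<subseteq> insert e S"
      proof cases
        case 1 then show ?thesis using S(2) unfolding cycle_faces_def by blast
      next
        case 2 then show ?thesis using b1 cc cyc c(2) by blast
      next
        case 3 then show ?thesis using b2 cc cyc c(2) by blast
      qed
    qed
    show "face_weight E crv F = face_weight E crv F1 + face_weight E crv F2"
      using face_weight_eq(1)[OF c(1)] face_weight_eq(1)[OF b1] face_weight_eq(1)[OF b2] pq(3)
      by (simp add: q'_def)
    show "path_image (crv f) \<subseteq> frontier F1 \<or> path_image (crv f) \<subseteq> frontier F2"
      if "f \<in> E" "path_image (crv f) \<subseteq> frontier F" for f
      using that bounding_cycle_edges[OF c(1)] bounding_cycle_edges[OF b1] bounding_cycle_edges[OF b2]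
        cyc cc by blast
  qed
qed

definition side_weight where
  "side_weight S D = (\<Sum>F | F \<in> components (- drawn S) \<and> F \<subseteq> D. face_weight E crv F)"

lemma hamiltonian_sides:
  assumes H: "hamiltonian_cycle V E H" and J: "J = drawn (cycle_edges H)"
  shows "components (- J) = {inside J, outside J}" "inside J \<noteq> {}" "outside J \<noteq> {}"
    "bounding_cycle E crv (inside J) H" "bounding_cycle E crv (outside J) H"
proof -
  have el: "elementary_cycle E H" using H by (simp add: hamiltonian_cycle_def)
  obtain g h a b where gh: "arc_pair g h a b" "J = path_image g \<union> path_image h"
    using elementary_cycle_arc_pair[OF el] J by metis
  note jordan = Jordan_arc_pair[OF gh(1), folded gh(2)]
  show "components (- J) = {inside J, outside J}" "inside J \<noteq> {}" "outside J \<noteq> {}"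
    using Jordan_arc_pair_components[OF gh(1), folded gh(2)] jordan by auto
  show "bounding_cycle E crv (inside J) H" "bounding_cycle E crv (outside J) H"
    unfolding bounding_cycle_eq using el jordan J by auto
qed

text \<open>Besides the weight, the invariant records that each edge of \<open>H\<close> lies on the frontier of some
  face on either side; this gives one inclusion of the border.\<close>

lemma sides_balanced:
  assumes H: "hamiltonian_cycle V E H" and J: "J = drawn (cycle_edges H)"
    and T: "finite T" "T \<subseteq> E - cycle_edges H"
  shows "finite (components (- drawn (cycle_edges H \<union> T))) \<and> cycle_faces (cycle_edges H \<union> T) \<and>
    (\<forall>D\<in>{inside J, outside J}. side_weight (cycle_edges H \<union> T) D = int (card V) - 2 \<and>
      (\<forall>f\<in>cycle_edges H. \<exists>F\<in>components (- drawn (cycle_edges H \<union> T)).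
         F \<subseteq> D \<and> path_image (crv f) \<subseteq> frontier F))"
  using T
proof (induction T rule: finite_induct)
  case empty
  have fw: "face_weight E crv D = int (card V) - 2" if "D \<in> {inside J, outside J}" for D
    using that face_weight_eq(1)[OF hamiltonian_sides(4)[OF H J]]
      face_weight_eq(1)[OF hamiltonian_sides(5)[OF H J]] H
    by (auto simp: hamiltonian_cycle_def elementary_cycle_def distinct_card)
  have "{F. F \<in> {inside J, outside J} \<and> F \<subseteq> D} = {D}" if "D \<in> {inside J, outside J}" for D
    using that hamiltonian_sides(2,3)[OF H J] inside_Int_outside[of J] by blast
  then have sw: "side_weight (cycle_edges H) D = int (card V) - 2"
      if "D \<in> {inside J, outside J}" for D
    using that fw unfolding side_weight_def J[symmetric] hamiltonian_sides(1)[OF H J] by simp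
  have "cycle_faces (cycle_edges H)"
    unfolding cycle_faces_def J[symmetric] hamiltonian_sides(1)[OF H J]
    using hamiltonian_sides(4,5)[OF H J] by auto
  moreover have "path_image (crv f) \<subseteq> frontier D" if "f \<in> cycle_edges H" "D \<in> {inside J, outside J}" for f D
    using that bounding_cycle_edges[OF hamiltonian_sides(4)[OF H J]]
      bounding_cycle_edges[OF hamiltonian_sides(5)[OF H J]] by blast
  ultimately show ?case
    using sw unfolding Un_empty_right J[symmetric] hamiltonian_sides(1)[OF H J] by blast
next
  case (insert e T)
  let ?S = "cycle_edges H \<union> T"
  let ?C = "components (- drawn ?S)"
  have HE: "cycle_edges H \<subseteq> E" "set H = V" "3 \<le> length H"
    using H by (auto simp: hamiltonian_cycle_def elementary_cycle_def)
  have S: "?S \<subseteq> E" and e: "e \<in> E" "e \<notin> ?S" using insert HE by auto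
  have IH: "finite ?C" "cycle_faces ?S"
    "\<And>D. D \<in> {inside J, outside J} \<Longrightarrow> side_weight ?S D = int (card V) - 2"
    "\<And>D f. D \<in> {inside J, outside J} \<Longrightarrow> f \<in> cycle_edges H \<Longrightarrow>
       \<exists>F\<in>?C. F \<subseteq> D \<and> path_image (crv f) \<subseteq> frontier F"
    using insert by auto
  have "H \<noteq> []" using HE(3) by auto
  then have "V \<subseteq> \<Union>(cycle_edges H)"
    using HE(2) Union_cycle_edges[of H] by blast
  then have "e \<subseteq> \<Union>?S" using edges[OF e(1)] by blast
  from add_chord[OF S IH(2) e this] obtain F F1 F2 where F: "F \<in> ?C"
    and comps: "components (- drawn (Set.insert e ?S)) = ?C - {F} \<union> {F1, F2}"
    and new: "F1 \<notin> ?C" "F2 \<notin> ?C" "F1 \<noteq> F2"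
    and sub: "F1 \<subseteq> F" "F2 \<subseteq> F" "F1 \<noteq> {}" "F2 \<noteq> {}" and cf: "cycle_faces (Set.insert e ?S)"
    and w: "face_weight E crv F = face_weight E crv F1 + face_weight E crv F2"
    and fr: "\<And>f. f \<in> E \<Longrightarrow> path_image (crv f) \<subseteq> frontier F \<Longrightarrow>
       path_image (crv f) \<subseteq> frontier F1 \<or> path_image (crv f) \<subseteq> frontier F2"
    by blast
  \<comment> \<open>The chord affects only one of the two sides, the one that contains the face it cuts.\<close>
  have "J \<subseteq> drawn ?S" using J by (auto simp: drawn_Un)
  then have "F \<inter> J = {}" using in_components_subset[OF F] by blast
  then have FD: "F \<subseteq> inside J \<or> F \<subseteq> outside J"
    using connected_inside_or_outside[OF in_components_connected[OF F]] closed_drawn[OF HE(1)] J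
    by simp
  have side: "X \<subseteq> D \<longleftrightarrow> F \<subseteq> D" if "X \<subseteq> F" "X \<noteq> {}" "D \<in> {inside J, outside J}" for X D
    using FD that inside_Int_outside[of J] by blast
  have "side_weight (Set.insert e ?S) D = int (card V) - 2" if D: "D \<in> {inside J, outside J}" for D
  proof (cases "F \<subseteq> D")
    case True
    let ?A = "{X. X \<in> ?C \<and> X \<subseteq> D} - {F}"
    have fin: "finite ?A" using IH(1) by simp
    have "{X. X \<in> ?C - {F} \<union> {F1, F2} \<and> X \<subseteq> D} = insert F1 (insert F2 ?A)"
      using side[OF sub(1,3) D] side[OF sub(2,4) D] True by blast
    moreover have "F1 \<notin> insert F2 ?A" "F2 \<notin> ?A" using new by auto
    ultimately have "side_weight (Set.insert e ?S) D =
        face_weight E crv F1 + (face_weight E crv F2 + (\<Sum>X\<in>?A. face_weight E crv X))"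
      unfolding side_weight_def comps using fin by simp
    also have "\<dots> = side_weight ?S D"
      using sum.remove[of "{X. X \<in> ?C \<and> X \<subseteq> D}" F "face_weight E crv"] F True IH(1) w
      unfolding side_weight_def by simp
    finally show ?thesis using IH(3)[OF D] by simp
  next
    case False
    then have "{X. X \<in> ?C - {F} \<union> {F1, F2} \<and> X \<subseteq> D} = {X. X \<in> ?C \<and> X \<subseteq> D}"
      using side[OF sub(1,3) D] side[OF sub(2,4) D] by blast
    then show ?thesis using IH(3)[OF D] unfolding side_weight_def comps by simp
  qed
  moreover have "\<exists>X\<in>?C - {F} \<union> {F1, F2}. X \<subseteq> D \<and> path_image (crv f) \<subseteq> frontier X"
    if D: "D \<in> {inside J, outside J}" and f: "f \<in> cycle_edges H" for D f
  proof -
    obtain X where X: "X \<in> ?C" "X \<subseteq> D" "path_image (crv f) \<subseteq> frontier X"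
      using IH(4)[OF D f] by blast
    show ?thesis
    proof (cases "X = F")
      case True
      have "path_image (crv f) \<subseteq> frontier F1 \<or> path_image (crv f) \<subseteq> frontier F2"
        using fr[of f] X(3) True f HE(1) by auto
      moreover have "F1 \<subseteq> D" "F2 \<subseteq> D" using X(2) True sub(1,2) by auto
      ultimately show ?thesis by auto
    next
      case False
      then show ?thesis using X by blast
    qed
  qed
  moreover have "finite (?C - {F} \<union> {F1, F2})" using IH(1) by simp
  ultimately show ?case
    using cf unfolding Un_insert_right comps by (intro conjI ballI)
qed

end

section \<open>The isobaric partition\<close>

theorem mainTheorem1:
  fixes V :: "'a set" and E :: "'a set set" and H :: "'a list"
    and pos :: "'a \<Rightarrow> complex" and crv :: "'a set \<Rightarrow> real \<Rightarrow> complex"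
  assumes "planar_graph V E"
    and "hamiltonian_cycle V E H"
    and "plane_embedding V E pos crv"
  shows "\<exists>A B. isobaric_partition V E pos crv A B \<and> partition_border E crv A B = cycle_edges H"
proof -
  interpret plane_embedding V E pos crv by fact
  note H = assms(2)
  define J where "J = drawn (cycle_edges H)"
  have HE: "cycle_edges H \<subseteq> E" "set H = V" "3 \<le> length H"
    using H by (auto simp: hamiltonian_cycle_def elementary_cycle_def)
  have "H \<noteq> []" using HE(3) by auto
  then have "V \<subseteq> \<Union>E" using HE(1,2) Union_cycle_edges[of H] by blast
  then have "pos ` V \<subseteq> drawn E" using pos_in_drawn[of E] by blast
  then have "drawing V E pos crv = drawn E"
    by (auto simp: drawing_def drawn_def)
  then have faces: "faces V E pos crv = components (- drawn E)"
    by (simp add: faces_def)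
  let ?side = "\<lambda>D. {F. F \<in> components (- drawn E) \<and> F \<subseteq> D}"
  have "cycle_edges H \<union> (E - cycle_edges H) = E" using HE by blast
  then have weight: "side_weight E D = int (card V) - 2"
    and border: "\<And>f. f \<in> cycle_edges H \<Longrightarrow> \<exists>F\<in>?side D. path_image (crv f) \<subseteq> frontier F"
    if "D \<in> {inside J, outside J}" for D
    using sides_balanced[OF H J_def, of "E - cycle_edges H"] finite_edges that by auto
  have cover: "F \<subseteq> inside J \<or> F \<subseteq> outside J" if F: "F \<in> components (- drawn E)" for F
  proof -
    have "J \<subseteq> drawn E" using HE(1) by (auto simp: J_def drawn_def)
    then have "F \<inter> J = {}" using in_components_subset[OF F] by blast
    then show ?thesis
      using connected_inside_or_outside[OF in_components_connected[OF F]] closed_drawn[OF HE(1)]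
      by (simp add: J_def)
  qed
  have "F = {}" if "F \<subseteq> inside J" "F \<subseteq> outside J" for F
    using that inside_Int_outside[of J] by blast
  then have "?side (inside J) \<inter> ?side (outside J) = {}"
    using in_components_nonempty[of _ "- drawn E"] by auto
  moreover have "?side (inside J) \<union> ?side (outside J) = components (- drawn E)"
    using cover by blast
  ultimately have iso: "isobaric_partition V E pos crv (?side (inside J)) (?side (outside J))"
    using weight[of "inside J"] weight[of "outside J"]
    by (simp add: isobaric_partition_def faces side_weight_def)
  have "partition_border E crv (?side (inside J)) (?side (outside J)) = cycle_edges H"
  proof (intro equalityI subsetI)
    fix e assume "e \<in> cycle_edges H"
    then show "e \<in> partition_border E crv (?side (inside J)) (?side (outside J))"
      using border[of "inside J" e] border[of "outside J" e] HE(1)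
      unfolding partition_border_def by blast
  next
    fix e assume "e \<in> partition_border E crv (?side (inside J)) (?side (outside J))"
    then obtain F G where e: "e \<in> E" "path_image (crv e) \<subseteq> frontier F"
        "path_image (crv e) \<subseteq> frontier G" and FG: "F \<subseteq> inside J" "G \<subseteq> outside J"
      unfolding partition_border_def by blast
    have fr: "frontier (inside J) = J" "frontier (outside J) = J"
      using hamiltonian_sides(4,5)[OF H J_def] by (simp_all add: bounding_cycle_eq J_def)
    \<comment> \<open>The closures of the two sides have only \<open>J\<close> in common.\<close>
    have "path_image (crv e) \<subseteq> closure (inside J)" "path_image (crv e) \<subseteq> closure (outside J)"
      using e FG[THEN closure_mono] by (auto simp: frontier_def)
    then have "path_image (crv e) \<subseteq> J"
      using inside_Int_outside[of J] unfolding closure_Un_frontier fr by blast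
    then show "e \<in> cycle_edges H"
      using edge_subset_drawn[OF e(1) HE(1)] by (simp add: J_def)
  qed
  with iso show ?thesis by blast
qed

end
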